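(* The variety $\mathbf{V(D_2)}$ generated by $\mathbf{D_2}$ is defined, modulo $\mathbf{JIDL_1}$, by the identity $x''\approx x$; that is, $\mathbf{V(D_2)}$ is exactly the class of algebras in $\mathbf{JIDL_1}$ satisfying $x''\approx x$.
   Context: A semi-Heyting algebra is an algebra $\langle L,\vee,\wedge,\to,0,1\rangle$ such that $\langle L,\vee,\wedge,0,1\rangle$ is a bounded lattice and the identities $x\wedge(x\to y)\approx x\wedge y$, $x\wedge(y\to z)\approx x\wedge[(x\wedge y)\to(x\wedge z)]$, $x\to x\approx 1$ hold. Write $x^*:=x\to 0$. A $\mathbf{DQD}$-algebra (dually quasi-De Morgan semi-Heyting algebra) is an algebra $\langle L,\vee,\wedge,\to,{}',0,1\rangle$ whose reduct $\langle L,\vee,\wedge,\to,0,1\rangle$ is a semi-Heyting algebra and which satisfies: $0'\approx 1$ and $1'\approx 0$; $(x\wedge y)'\approx x'\vee y'$; $(x\vee y)''\approx x''\vee y''$; $x''\le x$. $\mathbf{DQD}$ denotes the variety of all $\mathbf{DQD}$-algebras. $\mathbf{JIDL_1}$ is the subvariety of $\mathbf{DQD}$ defined by the identities $x'\vee(y\to z)\approx(x'\vee y)\to(x'\vee z)$, $(x\to y)\vee(y\to x)\approx 1$, and $x\wedge x'^{*}\approx (x\wedge x'^{*})'^{*}$ (where $z'^*$ means $(z')^*$); in the presence of the first identity, the last is equivalent to the level-1 identity $x\wedge x'^*\approx x\wedge x'^*\wedge x'^*{}'^*$. $\mathbf{D_2}$ is the $\mathbf{DQD}$-algebra whose reduct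 without $'$ is the four-element Boolean algebra $\{0,a,b,1\}$ with its Heyting implication ($x\to y$ is the join of the complement of $x$ with $y$), and with $0'=1$, $1'=0$, $a'=a$, $b'=b$. *)

theory Defs
  imports "HOL-Algebra.Congruence"
begin

section \<open>Algebras in the language of dually quasi-De Morgan semi-Heyting algebras\<close>

record 'a dqd_alg = "'a partial_object" +
  dvee :: "'a \<Rightarrow> 'a \<Rightarrow> 'a" (infixl "\<squnion>\<index>" 65)
  dwedge :: "'a \<Rightarrow> 'a \<Rightarrow> 'a" (infixl "\<sqinter>\<index>" 70)
  dimp :: "'a \<Rightarrow> 'a \<Rightarrow> 'a" (infixr "\<leadsto>\<index>" 60)
  dprime :: "'a \<Rightarrow> 'a" ("_\<acute>\<index>" [1000] 1000)
  dbot :: 'a ("\<bottom>\<index>")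
  dtop :: 'a ("\<top>\<index>")

definition pcomp :: "'a dqd_alg \<Rightarrow> 'a \<Rightarrow> 'a" ("_\<^sup>\<star>\<index>" [1000] 1000)
  where "pcomp L x = x \<leadsto>\<^bsub>L\<^esub> \<bottom>\<^bsub>L\<^esub>"

locale dqd_signature =
  fixes L :: "'a dqd_alg" (structure)
  assumes vee_closed: "\<lbrakk>x \<in> carrier L; y \<in> carrier L\<rbrakk> \<Longrightarrow> x \<squnion> y \<in> carrier L"
    and wedge_closed: "\<lbrakk>x \<in> carrier L; y \<in> carrier L\<rbrakk> \<Longrightarrow> x \<sqinter> y \<in> carrier L"
    and imp_closed: "\<lbrakk>x \<in> carrier L; y \<in> carrier L\<rbrakk> \<Longrightarrow> x \<leadsto> y \<in> carrier L"
    and prime_closed: "x \<in> carrier L \<Longrightarrow> x\<acute> \<in> carrier L"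
    and zero_closed: "\<bottom> \<in> carrier L"
    and one_closed: "\<top> \<in> carrier L"

locale semi_heyting = dqd_signature +
  assumes vee_comm: "\<lbrakk>x \<in> carrier L; y \<in> carrier L\<rbrakk> \<Longrightarrow> x \<squnion> y = y \<squnion> x"
    and wedge_comm: "\<lbrakk>x \<in> carrier L; y \<in> carrier L\<rbrakk> \<Longrightarrow> x \<sqinter> y = y \<sqinter> x"
    and vee_assoc: "\<lbrakk>x \<in> carrier L; y \<in> carrier L; z \<in> carrier L\<rbrakk>
      \<Longrightarrow> (x \<squnion> y) \<squnion> z = x \<squnion> (y \<squnion> z)"
    and wedge_assoc: "\<lbrakk>x \<in> carrier L; y \<in> carrier L; z \<in> carrier L\<rbrakk>
      \<Longrightarrow> (x \<sqinter> y) \<sqinter> z = x \<sqinter> (y \<sqinter> z)"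
    and vee_absorb: "\<lbrakk>x \<in> carrier L; y \<in> carrier L\<rbrakk> \<Longrightarrow> x \<squnion> (x \<sqinter> y) = x"
    and wedge_absorb: "\<lbrakk>x \<in> carrier L; y \<in> carrier L\<rbrakk> \<Longrightarrow> x \<sqinter> (x \<squnion> y) = x"
    and wedge_zero: "x \<in> carrier L \<Longrightarrow> x \<sqinter> \<bottom> = \<bottom>"
    and vee_one: "x \<in> carrier L \<Longrightarrow> x \<squnion> \<top> = \<top>"
    and wedge_imp: "\<lbrakk>x \<in> carrier L; y \<in> carrier L\<rbrakk> \<Longrightarrow> x \<sqinter> (x \<leadsto> y) = x \<sqinter> y"
    and wedge_imp_distrib: "\<lbrakk>x \<in> carrier L; y \<in> carrier L; z \<in> carrier L\<rbrakk>
      \<Longrightarrow> x \<sqinter> (y \<leadsto> z) = x \<sqinter> ((x \<sqinter> y) \<leadsto> (x \<sqinter> z))"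
    and imp_refl: "x \<in> carrier L \<Longrightarrow> x \<leadsto> x = \<top>"

locale DQD = semi_heyting +
  assumes prime_zero: "\<bottom>\<acute> = \<top>"
    and prime_one: "\<top>\<acute> = \<bottom>"
    and prime_wedge: "\<lbrakk>x \<in> carrier L; y \<in> carrier L\<rbrakk> \<Longrightarrow> (x \<sqinter> y)\<acute> = x\<acute> \<squnion> y\<acute>"
    and prime_prime_vee: "\<lbrakk>x \<in> carrier L; y \<in> carrier L\<rbrakk>
      \<Longrightarrow> (x \<squnion> y)\<acute>\<acute> = x\<acute>\<acute> \<squnion> y\<acute>\<acute>"
    \<comment> \<open>the inequality \<open>x'' \<le> x\<close> in terms of the lattice order\<close>
    and prime_prime_le: "x \<in> carrier L \<Longrightarrow> x\<acute>\<acute> \<sqinter> x = x\<acute>\<acute>"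

locale JIDL1 = DQD +
  assumes prime_vee_imp: "\<lbrakk>x \<in> carrier L; y \<in> carrier L; z \<in> carrier L\<rbrakk>
      \<Longrightarrow> x\<acute> \<squnion> (y \<leadsto> z) = (x\<acute> \<squnion> y) \<leadsto> (x\<acute> \<squnion> z)"
    and linearity: "\<lbrakk>x \<in> carrier L; y \<in> carrier L\<rbrakk> \<Longrightarrow> (x \<leadsto> y) \<squnion> (y \<leadsto> x) = \<top>"
    and level_one: "x \<in> carrier L \<Longrightarrow> x \<sqinter> x\<acute>\<^sup>\<star> = (x \<sqinter> x\<acute>\<^sup>\<star>)\<acute>\<^sup>\<star>"


section \<open>Generated varieties\<close>

definition dqd_product :: "'i set \<Rightarrow> ('i \<Rightarrow> 'b dqd_alg) \<Rightarrow> ('i \<Rightarrow> 'b) dqd_alg"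
  where "dqd_product I F =
    \<lparr>carrier = (\<Pi>\<^sub>E i\<in>I. carrier (F i)),
     dvee = (\<lambda>f g. \<lambda>i\<in>I. f i \<squnion>\<^bsub>F i\<^esub> g i),
     dwedge = (\<lambda>f g. \<lambda>i\<in>I. f i \<sqinter>\<^bsub>F i\<^esub> g i),
     dimp = (\<lambda>f g. \<lambda>i\<in>I. f i \<leadsto>\<^bsub>F i\<^esub> g i),
     dprime = (\<lambda>f. \<lambda>i\<in>I. (f i)\<acute>\<^bsub>F i\<^esub>),
     dbot = (\<lambda>i\<in>I. \<bottom>\<^bsub>F i\<^esub>),
     dtop = (\<lambda>i\<in>I. \<top>\<^bsub>F i\<^esub>)\<rparr>"

definition dqd_subalgebra :: "'a dqd_alg \<Rightarrow> 'a dqd_alg \<Rightarrow> bool"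
  where "dqd_subalgebra B L \<longleftrightarrow>
    (\<exists>S \<subseteq> carrier L. B = L\<lparr>carrier := S\<rparr>) \<and> dqd_signature B"

definition dqd_hom :: "'a dqd_alg \<Rightarrow> 'b dqd_alg \<Rightarrow> ('a \<Rightarrow> 'b) set"
  where "dqd_hom L M = {h \<in> carrier L \<rightarrow> carrier M.
    (\<forall>x\<in>carrier L. \<forall>y\<in>carrier L.
       h (x \<squnion>\<^bsub>L\<^esub> y) = h x \<squnion>\<^bsub>M\<^esub> h y \<and>
       h (x \<sqinter>\<^bsub>L\<^esub> y) = h x \<sqinter>\<^bsub>M\<^esub> h y \<and>
       h (x \<leadsto>\<^bsub>L\<^esub> y) = h x \<leadsto>\<^bsub>M\<^esub> h y) \<and>
    (\<forall>x\<in>carrier L. h (x\<acute>\<^bsub>L\<^esub>) = (h x)\<acute>\<^bsub>M\<^esub>) \<and>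
    h \<bottom>\<^bsub>L\<^esub> = \<bottom>\<^bsub>M\<^esub> \<and> h \<top>\<^bsub>L\<^esub> = \<top>\<^bsub>M\<^esub>}"

text \<open>
  The variety generated by a class \<open>K\<close>, i.e. the least class containing \<open>K\<close> and closed under
  homomorphic images, subalgebras and direct products, is \<open>HSP(K)\<close>.  The predicate below is
  membership in \<open>HSP(K)\<close> with the products indexed by subsets of the type \<open>'i\<close>.  Since HOL does not
  quantify over types inside formulas, the index type is a parameter; membership in the variety
  means that the predicate holds for some index type.  (By Birkhoff's construction of free
  algebras, for \<open>K = {B}\<close> with \<open>B\<close> of type \<open>'b dqd_alg\<close> and \<open>A\<close> of type \<open>'a dqd_alg\<close> the index type
  \<open>'a \<Rightarrow> 'b\<close> always suffices.)
\<close>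

definition in_HSP :: "'i itself \<Rightarrow> 'b dqd_alg set \<Rightarrow> 'a dqd_alg \<Rightarrow> bool"
  where "in_HSP (_ :: 'i itself) K A \<longleftrightarrow>
    (\<exists>(I :: 'i set) F B h.
       (\<forall>i\<in>I. F i \<in> K) \<and>
       dqd_subalgebra B (dqd_product I F) \<and>
       h \<in> dqd_hom B A \<and> h ` carrier B = carrier A)"


section \<open>The algebra \<open>D\<^sub>2\<close>\<close>

datatype four = F0 | Fa | Fb | F1

definition four_vee :: "four \<Rightarrow> four \<Rightarrow> four"
  where "four_vee x y = (if x = y then x else if x = F0 then y else if y = F0 then x else F1)"

definition four_wedge :: "four \<Rightarrow> four \<Rightarrow> four"
  where "four_wedge x y = (if x = y then x else if x = F1 then y else if y = F1 then x else F0)"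

fun four_compl :: "four \<Rightarrow> four"
  where "four_compl F0 = F1" | "four_compl Fa = Fb" | "four_compl Fb = Fa" | "four_compl F1 = F0"

fun four_prime :: "four \<Rightarrow> four"
  where "four_prime F0 = F1" | "four_prime Fa = Fa" | "four_prime Fb = Fb" | "four_prime F1 = F0"

definition D2 :: "four dqd_alg"
  where "D2 = \<lparr>carrier = UNIV, dvee = four_vee, dwedge = four_wedge,
    dimp = (\<lambda>x y. four_vee (four_compl x) y), dprime = four_prime, dbot = F0, dtop = F1\<rparr>"

lemma four_all: "(\<forall>x. P x) \<longleftrightarrow> P F0 \<and> P Fa \<and> P Fb \<and> P F1"
  by (metis four.exhaust)

lemma DQD_D2: "DQD D2"
  by (simp add: DQD_def DQD_axioms_def semi_heyting_def semi_heyting_axioms_def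
      dqd_signature_def D2_def four_vee_def four_wedge_def four_all)

end

theory Submission
  imports Defs
begin

text \<open>
  Let \<open>A\<close> be in \<open>JIDL1\<close> with \<open>x'' = x\<close>.  Every element of \<open>A\<close> is then of the form \<open>x'\<close>, so
  joining with an arbitrary \<open>x\<close> distributes over the implication, and
  \<open>x \<squnion> (x \<leadsto> \<bottom>) = (x \<squnion> x) \<leadsto> (x \<squnion> \<bottom>) = \<top>\<close>: the lattice of \<open>A\<close> is Boolean
  (\<open>vee_pcomp\<close>).  Linearity of the implication excludes the other semi-Heyting implications on a
  Boolean lattice, so that a prime filter contains \<open>x \<leadsto> y\<close> exactly when it omits \<open>x\<close> or contains
  \<open>y\<close> (\<open>prime_filter_imp\<close>).  The operation \<open>'\<close> is a De Morgan involution; hence every prime filter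
  \<open>U\<close> has a conjugate prime filter \<open>{x. x' \<notin> U}\<close>, and since \<open>D2\<close> is the square of the two-element
  Boolean algebra with the involution built from the exchange of coordinates, the two membership
  values \<open>x \<in> U\<close> and \<open>x' \<notin> U\<close> form a homomorphism from \<open>A\<close> to \<open>D2\<close>
  (\<open>filter_hom_in_dqd_hom\<close>).  By Zorn's lemma there are enough prime filters for these
  homomorphisms to separate the points of \<open>A\<close> (\<open>D2_homs_separate\<close>), so \<open>A\<close> embeds into the power of
  \<open>D2\<close> indexed by all homomorphisms from \<open>A\<close> to \<open>D2\<close>.

  Conversely, \<open>D2\<close> satisfies all the defining identities, and identities are inherited by algebras
  whose points are separated by homomorphisms into \<open>D2\<close>, in particular by subalgebras of powers of
  \<open>D2\<close>, and by homomorphic images.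
\<close>

section \<open>Preservation of the identities\<close>

text \<open>The algebras in \<open>JIDL1\<close> in which \<open>'\<close> is an involution.\<close>
locale involutive_JIDL1 = JIDL1 +
  assumes prime_prime: "x \<in> carrier L \<Longrightarrow> x\<acute>\<acute> = x"

lemma involutive_JIDL1_D2: "involutive_JIDL1 D2"
  by (simp add: involutive_JIDL1_def involutive_JIDL1_axioms_def JIDL1_def JIDL1_axioms_def DQD_D2)
    (simp add: D2_def pcomp_def four_vee_def four_wedge_def four_all)

lemma dqd_homD:
  assumes "h \<in> dqd_hom L M"
  shows "x \<in> carrier L \<Longrightarrow> h x \<in> carrier M"
    and "\<lbrakk>x \<in> carrier L; y \<in> carrier L\<rbrakk> \<Longrightarrow> h (x \<squnion>\<^bsub>L\<^esub> y) = h x \<squnion>\<^bsub>M\<^esub> h y"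
    and "\<lbrakk>x \<in> carrier L; y \<in> carrier L\<rbrakk> \<Longrightarrow> h (x \<sqinter>\<^bsub>L\<^esub> y) = h x \<sqinter>\<^bsub>M\<^esub> h y"
    and "\<lbrakk>x \<in> carrier L; y \<in> carrier L\<rbrakk> \<Longrightarrow> h (x \<leadsto>\<^bsub>L\<^esub> y) = h x \<leadsto>\<^bsub>M\<^esub> h y"
    and "x \<in> carrier L \<Longrightarrow> h (x\<acute>\<^bsub>L\<^esub>) = (h x)\<acute>\<^bsub>M\<^esub>"
    and "h \<bottom>\<^bsub>L\<^esub> = \<bottom>\<^bsub>M\<^esub>"
    and "h \<top>\<^bsub>L\<^esub> = \<top>\<^bsub>M\<^esub>"
  using assms by (auto simp: dqd_hom_def)

text \<open>All identities in the primitive operations, that is, with \<open>pcomp\<close> unfolded.\<close>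
lemmas (in involutive_JIDL1) identities =
  vee_comm wedge_comm vee_assoc wedge_assoc vee_absorb wedge_absorb wedge_zero vee_one
  wedge_imp wedge_imp_distrib imp_refl prime_zero prime_one prime_wedge prime_prime_vee
  prime_prime_le prime_vee_imp linearity level_one[unfolded pcomp_def] prime_prime

lemma involutive_JIDL1_separated:
  assumes sig: "dqd_signature B" and M: "involutive_JIDL1 M" and H: "H \<subseteq> dqd_hom B M"
    and sep: "\<And>x y. \<lbrakk>x \<in> carrier B; y \<in> carrier B; \<And>g. g \<in> H \<Longrightarrow> g x = g y\<rbrakk> \<Longrightarrow> x = y"
  shows "involutive_JIDL1 B"
proof -
  interpret dqd_signature B by (rule sig)
  interpret M: involutive_JIDL1 M by (rule M)
  note closed = vee_closed wedge_closed imp_closed prime_closed zero_closed one_closed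
  \<comment> \<open>Each identity is moved along the separating homomorphisms and becomes an instance in \<open>M\<close>.\<close>
  show ?thesis
    by unfold_locales
      (rule sep, simp_all only: closed dqd_homD[OF subsetD[OF H]] pcomp_def;
       rule M.identities; simp only: dqd_homD[OF subsetD[OF H]])+
qed

lemma involutive_JIDL1_image:
  assumes B: "involutive_JIDL1 B"
    and h: "h \<in> dqd_hom B A" and surj: "h ` carrier B = carrier A"
  shows "involutive_JIDL1 A"
proof -
  interpret B: involutive_JIDL1 B by (rule B)
  note closed = B.vee_closed B.wedge_closed B.imp_closed B.prime_closed B.zero_closed B.one_closed
  note pull = dqd_homD(2-7)[OF h, symmetric]
  \<comment> \<open>Elements of \<open>A\<close> are written as values of \<open>h\<close>, and the identities of \<open>B\<close> are mapped by \<open>h\<close>.\<close>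
  show ?thesis
    by unfold_locales
      ((unfold surj[symmetric])?, (elim imageE)?, simp only: pull closed pcomp_def,
       (rule imageI arg_cong[of _ _ h], (rule closed B.identities; assumption))?)+
qed

section \<open>Prime filters of semi-Heyting algebras\<close>

context semi_heyting
begin

lemma wedge_idem: "x \<in> carrier L \<Longrightarrow> x \<sqinter> x = x"
  by (metis vee_absorb vee_closed wedge_absorb wedge_closed)

lemma vee_idem: "x \<in> carrier L \<Longrightarrow> x \<squnion> x = x"
  by (metis vee_absorb wedge_idem)

lemma wedge_one: "x \<in> carrier L \<Longrightarrow> x \<sqinter> \<top> = x"
  by (metis vee_one wedge_absorb one_closed)

lemma vee_zero: "x \<in> carrier L \<Longrightarrow> x \<squnion> \<bottom> = x"
  by (metis vee_absorb wedge_zero zero_closed)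

lemma pcomp_closed: "x \<in> carrier L \<Longrightarrow> x\<^sup>\<star> \<in> carrier L"
  by (simp add: pcomp_def imp_closed zero_closed)

lemma wedge_pcomp: "x \<in> carrier L \<Longrightarrow> x \<sqinter> x\<^sup>\<star> = \<bottom>"
  by (simp add: pcomp_def wedge_imp wedge_zero zero_closed)

lemma wedge_left_mono:
  assumes "x \<in> carrier L" "y \<in> carrier L" "z \<in> carrier L" "x \<sqinter> y = x"
  shows "(x \<sqinter> z) \<sqinter> y = x \<sqinter> z"
  by (metis assms wedge_assoc wedge_comm)

lemma vee_least:
  assumes [simp]: "x \<in> carrier L" "y \<in> carrier L" "z \<in> carrier L"
    and "x \<sqinter> z = x" "y \<sqinter> z = y"
  shows "(x \<squnion> y) \<sqinter> z = x \<squnion> y"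
proof -
  have "z \<squnion> x = z" "z \<squnion> y = z"
    using assms by (metis vee_absorb wedge_comm)+
  then have "(x \<squnion> y) \<squnion> z = z"
    by (metis assms(1-3) vee_assoc vee_comm vee_closed)
  then show ?thesis by (metis assms(1-3) wedge_absorb vee_closed)
qed

text \<open>
  In the order \<open>x \<le> y \<longleftrightarrow> x \<sqinter> y = x\<close>, the element \<open>u \<leadsto> (u \<sqinter> z)\<close> is the relative pseudocomplement of
  \<open>u\<close> with respect to \<open>z\<close>; \<open>u \<leadsto> z\<close> itself may be strictly smaller.  This residuation replaces
  appeals to distributivity of the lattice.
\<close>
lemma wedge_le_iff:
  assumes [simp]: "x \<in> carrier L" "u \<in> carrier L" "z \<in> carrier L"
  shows "(x \<sqinter> u) \<sqinter> z = x \<sqinter> u \<longleftrightarrow> x \<sqinter> (u \<leadsto> u \<sqinter> z) = x"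
proof
  assume a: "(x \<sqinter> u) \<sqinter> z = x \<sqinter> u"
  have "x \<sqinter> (u \<leadsto> u \<sqinter> z) = x \<sqinter> ((x \<sqinter> u) \<leadsto> (x \<sqinter> (u \<sqinter> z)))"
    by (rule wedge_imp_distrib) (simp_all add: wedge_closed)
  also have "x \<sqinter> (u \<sqinter> z) = x \<sqinter> u"
    using a by (simp add: wedge_assoc)
  finally show "x \<sqinter> (u \<leadsto> u \<sqinter> z) = x"
    by (simp add: imp_refl wedge_closed wedge_one)
next
  let ?r = "u \<leadsto> u \<sqinter> z"
  have r: "?r \<in> carrier L" by (simp add: imp_closed wedge_closed)
  assume a: "x \<sqinter> ?r = x"
  have "x \<sqinter> u = x \<sqinter> (u \<sqinter> ?r)"
    by (metis a r assms(1,2) wedge_assoc wedge_comm)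
  also have "u \<sqinter> ?r = u \<sqinter> z"
    by (simp add: wedge_imp wedge_closed wedge_assoc[symmetric] wedge_idem)
  finally have "x \<sqinter> u = x \<sqinter> (u \<sqinter> z)" .
  then show "(x \<sqinter> u) \<sqinter> z = x \<sqinter> u"
    by (metis assms wedge_assoc wedge_closed wedge_idem)
qed

lemma wedge_eq_zero_iff:
  assumes "x \<in> carrier L" "u \<in> carrier L"
  shows "x \<sqinter> u = \<bottom> \<longleftrightarrow> x \<sqinter> u\<^sup>\<star> = x"
  using wedge_le_iff[OF assms zero_closed] assms
  by (simp add: wedge_closed wedge_zero pcomp_def) metis

text \<open>
  Filters of the lattice; the backward direction of the meet condition gives closure under meets,
  the forward direction gives upward closure.  The whole carrier is allowed.
\<close>
definition lattice_filter :: "'a set \<Rightarrow> bool"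
  where "lattice_filter U \<longleftrightarrow> U \<subseteq> carrier L \<and> \<top> \<in> U \<and>
    (\<forall>x\<in>carrier L. \<forall>y\<in>carrier L. x \<sqinter> y \<in> U \<longleftrightarrow> x \<in> U \<and> y \<in> U)"

text \<open>Proper filters for which membership commutes with binary joins.\<close>
definition prime_filter :: "'a set \<Rightarrow> bool"
  where "prime_filter U \<longleftrightarrow> lattice_filter U \<and> \<bottom> \<notin> U \<and>
    (\<forall>x\<in>carrier L. \<forall>y\<in>carrier L. x \<squnion> y \<in> U \<longleftrightarrow> x \<in> U \<or> y \<in> U)"

lemma lattice_filter_upward:
  assumes "lattice_filter U" "x \<in> U" "y \<in> carrier L" "x \<sqinter> y = x"
  shows "y \<in> U"
  using assms unfolding lattice_filter_def by (metis subsetD)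

text \<open>The filter generated by \<open>U\<close> and \<open>z\<close> is the set of upper bounds of the meets \<open>u \<sqinter> z\<close>.\<close>
lemma lattice_filter_generated:
  assumes U: "lattice_filter U" and z[simp]: "z \<in> carrier L"
  shows "lattice_filter {y \<in> carrier L. \<exists>u\<in>U. (u \<sqinter> z) \<sqinter> y = u \<sqinter> z}" (is "lattice_filter ?V")
  unfolding lattice_filter_def
proof (intro conjI ballI)
  have UL: "\<And>u. u \<in> U \<Longrightarrow> u \<in> carrier L" using U by (auto simp: lattice_filter_def)
  show "?V \<subseteq> carrier L" by auto
  show "\<top> \<in> ?V" using U
    by (auto simp: lattice_filter_def one_closed wedge_closed wedge_one intro!: bexI[of _ \<top>])
  fix x y assume [simp]: "x \<in> carrier L" "y \<in> carrier L"
  show "x \<sqinter> y \<in> ?V \<longleftrightarrow> x \<in> ?V \<and> y \<in> ?V"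
  proof (intro iffI conjI)
    assume "x \<sqinter> y \<in> ?V"
    then obtain u where u: "u \<in> U" "(u \<sqinter> z) \<sqinter> (x \<sqinter> y) = u \<sqinter> z" by auto
    have c: "u \<sqinter> z \<in> carrier L" by (simp add: UL u wedge_closed)
    have "(u \<sqinter> z) \<sqinter> x = u \<sqinter> z" "(u \<sqinter> z) \<sqinter> y = u \<sqinter> z"
      by (metis u(2) c \<open>x \<in> carrier L\<close> \<open>y \<in> carrier L\<close> wedge_assoc wedge_comm wedge_idem wedge_closed)+
    with u show "x \<in> ?V" "y \<in> ?V" by auto
  next
    assume "x \<in> ?V \<and> y \<in> ?V"
    then obtain u v where u: "u \<in> U" "(u \<sqinter> z) \<sqinter> x = u \<sqinter> z"
      and v: "v \<in> U" "(v \<sqinter> z) \<sqinter> y = v \<sqinter> z" by auto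
    note [simp] = UL[OF u(1)] UL[OF v(1)]
    have uv: "u \<sqinter> v \<in> U" using U u v by (simp add: lattice_filter_def)
    have eq: "(u \<sqinter> v) \<sqinter> z = (u \<sqinter> z) \<sqinter> v" "(u \<sqinter> v) \<sqinter> z = (v \<sqinter> z) \<sqinter> u"
      using wedge_assoc wedge_comm wedge_closed z UL[OF u(1)] UL[OF v(1)] by metis+
    have "((u \<sqinter> v) \<sqinter> z) \<sqinter> x = (u \<sqinter> v) \<sqinter> z"
      unfolding eq(1) by (rule wedge_left_mono) (simp_all add: u wedge_closed)
    moreover have "((u \<sqinter> v) \<sqinter> z) \<sqinter> y = (u \<sqinter> v) \<sqinter> z"
      unfolding eq(2) by (rule wedge_left_mono) (simp_all add: v wedge_closed)
    ultimately have "((u \<sqinter> v) \<sqinter> z) \<sqinter> (x \<sqinter> y) = (u \<sqinter> v) \<sqinter> z"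
      by (simp add: wedge_assoc[symmetric] wedge_closed)
    then show "x \<sqinter> y \<in> ?V" using uv by (auto simp: wedge_closed)
  qed
qed

lemma maximal_filter_exists:
  assumes c: "c \<in> carrier L" "c \<noteq> \<bottom>"
  obtains U where "lattice_filter U" "\<bottom> \<notin> U" "c \<in> U"
    and "\<And>V. \<lbrakk>lattice_filter V; \<bottom> \<notin> V; U \<subseteq> V\<rbrakk> \<Longrightarrow> V = U"
proof -
  let ?\<F> = "{U. lattice_filter U \<and> \<bottom> \<notin> U \<and> c \<in> U}"
  have top: "lattice_filter {\<top>}"
    unfolding lattice_filter_def
    by (simp add: one_closed)
      (metis one_closed wedge_one wedge_absorb vee_one wedge_assoc wedge_comm wedge_idem)
  \<comment> \<open>The principal filter of \<open>c\<close>, in the form of a generated filter.\<close>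
  have gen: "lattice_filter {y \<in> carrier L. \<exists>u\<in>{\<top>}. (u \<sqinter> c) \<sqinter> y = u \<sqinter> c}" (is "lattice_filter ?G")
    by (rule lattice_filter_generated[OF top c(1)])
  have tc: "\<top> \<sqinter> c = c" using c by (metis one_closed wedge_comm wedge_one)
  have "?G \<in> ?\<F>" using c gen by (simp add: tc wedge_idem wedge_zero)
  then have ne: "?\<F> \<noteq> {}" by blast
  have chain: "\<Union>\<C> \<in> ?\<F>" if ne: "\<C> \<noteq> {}" and ch: "subset.chain ?\<F> \<C>" for \<C>
  proof -
    have F: "\<And>U. U \<in> \<C> \<Longrightarrow> lattice_filter U \<and> \<bottom> \<notin> U \<and> c \<in> U"
      using ch by (auto simp: subset.chain_def)
    have lin: "U \<subseteq> V \<or> V \<subseteq> U" if "U \<in> \<C>" "V \<in> \<C>" for U V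
      using ch that unfolding subset.chain_def by blast
    have "lattice_filter (\<Union>\<C>)"
      unfolding lattice_filter_def
    proof (intro conjI ballI)
      show "\<Union>\<C> \<subseteq> carrier L" using F by (auto simp: lattice_filter_def)
      show "\<top> \<in> \<Union>\<C>" using F ne by (auto simp: lattice_filter_def)
      fix x y assume xy: "x \<in> carrier L" "y \<in> carrier L"
      have *: "x \<sqinter> y \<in> U \<longleftrightarrow> x \<in> U \<and> y \<in> U" if "U \<in> \<C>" for U
        using F[OF that] xy by (auto simp: lattice_filter_def)
      show "x \<sqinter> y \<in> \<Union>\<C> \<longleftrightarrow> x \<in> \<Union>\<C> \<and> y \<in> \<Union>\<C>"
        using * lin by (meson UnionE UnionI subsetD)
    qed
    with F ne show ?thesis by auto
  qed
  obtain U where "U \<in> ?\<F>" and "\<forall>X\<in>?\<F>. U \<subseteq> X \<longrightarrow> X = U"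
    using subset_Zorn_nonempty[OF ne chain] by blast
  then show thesis by (intro that[of U]) auto
qed

text \<open>
  By maximality the filter generated by \<open>U\<close> and \<open>z\<close> contains \<open>\<bottom>\<close>, so some member of \<open>U\<close> is disjoint
  from \<open>z\<close> and lies below \<open>z\<^sup>\<star>\<close>.
\<close>
lemma maximal_filter_pcomp:
  assumes U: "lattice_filter U" "\<bottom> \<notin> U"
    and max: "\<And>V. \<lbrakk>lattice_filter V; \<bottom> \<notin> V; U \<subseteq> V\<rbrakk> \<Longrightarrow> V = U"
    and z: "z \<in> carrier L" "z \<notin> U"
  shows "z\<^sup>\<star> \<in> U"
proof -
  let ?V = "{y \<in> carrier L. \<exists>u\<in>U. (u \<sqinter> z) \<sqinter> y = u \<sqinter> z}"
  have UL: "\<And>u. u \<in> U \<Longrightarrow> u \<in> carrier L" using U by (auto simp: lattice_filter_def)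
  have "U \<subseteq> ?V"
    using z UL wedge_left_mono wedge_idem by blast
  moreover have "z \<in> ?V"
    using z U by (auto simp: lattice_filter_def one_closed wedge_assoc wedge_idem intro!: bexI[of _ \<top>])
  ultimately have "\<bottom> \<in> ?V"
    using max[OF lattice_filter_generated[OF U(1) z(1)]] z by blast
  then obtain u where u: "u \<in> U" "(u \<sqinter> z) \<sqinter> \<bottom> = u \<sqinter> z" by auto
  then have "u \<sqinter> z\<^sup>\<star> = u"
    using z UL[OF u(1)] by (simp add: wedge_zero wedge_closed wedge_eq_zero_iff[symmetric])
  then show ?thesis
    using lattice_filter_upward[OF U(1) u(1)] pcomp_closed z by blast
qed

lemma prime_filter_exists:
  assumes c: "c \<in> carrier L" "c \<noteq> \<bottom>"
  obtains U where "prime_filter U" "c \<in> U"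
proof -
  obtain U where U: "lattice_filter U" "\<bottom> \<notin> U" "c \<in> U"
    and max: "\<And>V. \<lbrakk>lattice_filter V; \<bottom> \<notin> V; U \<subseteq> V\<rbrakk> \<Longrightarrow> V = U"
    by (rule maximal_filter_exists[OF c]) blast
  have "x \<squnion> y \<in> U \<longleftrightarrow> x \<in> U \<or> y \<in> U" if [simp]: "x \<in> carrier L" "y \<in> carrier L" for x y
  proof
    assume "x \<in> U \<or> y \<in> U"
    then show "x \<squnion> y \<in> U"
      using lattice_filter_upward[OF U(1)] that vee_closed wedge_absorb vee_comm by metis
  next
    assume xy: "x \<squnion> y \<in> U"
    show "x \<in> U \<or> y \<in> U"
    proof (rule ccontr)
      assume "\<not> (x \<in> U \<or> y \<in> U)"
      then have "x\<^sup>\<star> \<in> U" "y\<^sup>\<star> \<in> U"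
        using maximal_filter_pcomp[OF U(1,2) max] by auto
      define w where "w = x\<^sup>\<star> \<sqinter> y\<^sup>\<star>"
      have [simp]: "w \<in> carrier L" by (simp add: w_def wedge_closed pcomp_closed)
      have "w \<in> U" using \<open>x\<^sup>\<star> \<in> U\<close> \<open>y\<^sup>\<star> \<in> U\<close> U(1)
        by (simp add: w_def lattice_filter_def pcomp_closed)
      have "w \<sqinter> x\<^sup>\<star> = w" "w \<sqinter> y\<^sup>\<star> = w"
        unfolding w_def by (metis that pcomp_closed wedge_assoc wedge_comm wedge_idem)+
      then have "w \<sqinter> x = \<bottom>" "w \<sqinter> y = \<bottom>" by (simp_all add: wedge_eq_zero_iff)
      then have "x \<sqinter> w\<^sup>\<star> = x" "y \<sqinter> w\<^sup>\<star> = y"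
        by (simp_all add: wedge_eq_zero_iff[symmetric] wedge_comm)
      then have "(x \<squnion> y) \<sqinter> w\<^sup>\<star> = x \<squnion> y"
        by (intro vee_least) (simp_all add: pcomp_closed)
      then have "(x \<squnion> y) \<sqinter> w = \<bottom>"
        by (simp add: wedge_eq_zero_iff vee_closed)
      with xy \<open>w \<in> U\<close> U(1,2) show False
        by (metis lattice_filter_def that vee_closed \<open>w \<in> carrier L\<close>)
    qed
  qed
  with U show thesis by (intro that[of U]) (auto simp: prime_filter_def)
qed

end

section \<open>Homomorphisms to \<open>D\<^sub>2\<close>\<close>

context involutive_JIDL1
begin

text \<open>\<open>x = x''\<close> allows the identity \<open>x' \<squnion> (y \<leadsto> z) = (x' \<squnion> y) \<leadsto> (x' \<squnion> z)\<close> to be used at \<open>x'\<close>.\<close>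
lemma vee_pcomp: "x \<in> carrier L \<Longrightarrow> x \<squnion> x\<^sup>\<star> = \<top>"
  using prime_vee_imp[of "x\<acute>" x \<bottom>]
  by (simp add: prime_closed prime_prime zero_closed vee_idem vee_zero imp_refl pcomp_def)

lemma prime_vee: "\<lbrakk>x \<in> carrier L; y \<in> carrier L\<rbrakk> \<Longrightarrow> (x \<squnion> y)\<acute> = x\<acute> \<sqinter> y\<acute>"
  by (metis prime_prime prime_wedge prime_closed wedge_closed)

lemma le_if_wedge_pcomp_zero:
  assumes [simp]: "x \<in> carrier L" "y \<in> carrier L" and 0: "x \<sqinter> y\<^sup>\<star> = \<bottom>"
  shows "x \<sqinter> y = x"
proof -
  let ?r = "x \<leadsto> x \<sqinter> y"
  have [simp]: "?r \<in> carrier L" "y\<^sup>\<star> \<in> carrier L"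
    by (simp_all add: imp_closed wedge_closed pcomp_closed)
  have "y \<sqinter> ?r = y"
    unfolding wedge_le_iff[OF assms(2,1,2), symmetric]
    by (metis assms(1,2) wedge_assoc wedge_comm wedge_idem)
  \<comment> \<open>Both \<open>y\<close> and \<open>y\<^sup>\<star>\<close> lie below \<open>?r\<close>, hence so does their join, which is \<open>\<top>\<close>.\<close>
  moreover have "y\<^sup>\<star> \<sqinter> ?r = y\<^sup>\<star>"
    unfolding wedge_le_iff[OF \<open>y\<^sup>\<star> \<in> carrier L\<close> assms(1,2), symmetric]
    by (metis 0 \<open>y\<^sup>\<star> \<in> carrier L\<close> assms(1,2) wedge_comm wedge_zero zero_closed)
  ultimately have "\<top> \<sqinter> ?r = \<top>"
    using vee_least[of y "y\<^sup>\<star>" ?r] by (simp add: vee_pcomp)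
  then have "?r = \<top>" by (metis \<open>?r \<in> carrier L\<close> one_closed wedge_comm wedge_one)
  then show ?thesis
    using wedge_imp[of x "x \<sqinter> y"]
    by (simp add: wedge_closed wedge_one wedge_assoc[symmetric] wedge_idem)
qed

text \<open>
  The lattice being Boolean, the axioms of semi-Heyting algebras settle all cases except \<open>x \<notin> U\<close>,
  \<open>y \<in> U\<close>, where they leave the value of \<open>\<bottom> \<leadsto> \<top>\<close> in the two-element quotient open; there linearity
  decides.
\<close>
lemma prime_filter_imp:
  assumes P: "prime_filter U" and [simp]: "x \<in> carrier L" "y \<in> carrier L"
  shows "x \<leadsto> y \<in> U \<longleftrightarrow> (x \<in> U \<longrightarrow> y \<in> U)"
proof -
  have U: "\<bottom> \<notin> U" "\<top> \<in> U"
    and wedge: "\<And>x y. \<lbrakk>x \<in> carrier L; y \<in> carrier L\<rbrakk> \<Longrightarrow> x \<sqinter> y \<in> U \<longleftrightarrow> x \<in> U \<and> y \<in> U"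
    and vee: "\<And>x y. \<lbrakk>x \<in> carrier L; y \<in> carrier L\<rbrakk> \<Longrightarrow> x \<squnion> y \<in> U \<longleftrightarrow> x \<in> U \<or> y \<in> U"
    using P by (auto simp: prime_filter_def lattice_filter_def)
  have app: "u \<leadsto> v \<in> U \<longleftrightarrow> v \<in> U" if "u \<in> U" "u \<in> carrier L" "v \<in> carrier L" for u v
    using wedge_imp[of u v] wedge[of u "u \<leadsto> v"] wedge[of u v] that by (simp add: imp_closed)
  show ?thesis
  proof (cases "x \<in> U")
    case True
    then show ?thesis by (simp add: app)
  next
    case nx: False
    have "x \<leadsto> y \<in> U"
    proof (cases "y \<in> U")
      case True
      then have "y \<leadsto> x \<notin> U" by (simp add: app nx)
      then show ?thesis
        using linearity[of x y] vee[of "x \<leadsto> y" "y \<leadsto> x"] U by (simp add: imp_closed)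
    next
      case False
      \<comment> \<open>An element of \<open>U\<close> below which \<open>x\<close> and \<open>y\<close> both vanish, so that \<open>x \<leadsto> y\<close> becomes \<open>\<bottom> \<leadsto> \<bottom> = \<top>\<close>.\<close>
      define w where "w = (x \<squnion> y)\<^sup>\<star>"
      have [simp]: "w \<in> carrier L" by (simp add: w_def pcomp_closed vee_closed)
      have "w \<in> U"
        using vee[of "x \<squnion> y" w] vee[of x y] vee_pcomp[of "x \<squnion> y"] nx False U
        by (simp add: w_def[symmetric] vee_closed)
      have "w \<sqinter> (x \<squnion> y) = \<bottom>"
        using wedge_pcomp[of "x \<squnion> y"] wedge_comm[of w "x \<squnion> y"] by (simp add: w_def[symmetric] vee_closed)
      then have "w \<sqinter> x = \<bottom>" "w \<sqinter> y = \<bottom>"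
        by (metis assms(2,3) \<open>w \<in> carrier L\<close> vee_closed vee_comm wedge_absorb wedge_assoc wedge_comm
            wedge_zero zero_closed)+
      then have "w \<sqinter> (x \<leadsto> y) = w"
        using wedge_imp_distrib[of w x y] by (simp add: imp_refl zero_closed wedge_one)
      then show ?thesis
        using wedge[of w "x \<leadsto> y"] \<open>w \<in> U\<close> by (simp add: imp_closed)
    qed
    with nx show ?thesis by simp
  qed
qed

lemma prime_filter_conjugate:
  assumes "prime_filter U"
  shows "prime_filter {x \<in> carrier L. x\<acute> \<notin> U}"
  using assms
  by (auto simp: prime_filter_def lattice_filter_def prime_wedge prime_vee prime_zero prime_one
      prime_closed wedge_closed vee_closed zero_closed one_closed)

text \<open>
  The pair of truth values of \<open>x \<in> U\<close> and \<open>x' \<notin> U\<close>, where \<open>Fa\<close> stands for (true, false) and \<open>Fb\<close> for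
  (false, true).  Under this encoding the prime of \<open>D2\<close> exchanges and negates the two coordinates.
\<close>
definition filter_hom :: "'a set \<Rightarrow> 'a \<Rightarrow> four"
  where "filter_hom U x =
    (if x \<in> U then (if x\<acute> \<notin> U then F1 else Fa) else (if x\<acute> \<notin> U then Fb else F0))"

lemma filter_hom_in_dqd_hom:
  assumes U: "prime_filter U"
  shows "filter_hom U \<in> dqd_hom L D2"
proof -
  note V = prime_filter_conjugate[OF U]
  have 1: "\<bottom> \<notin> U" "\<top> \<in> U"
    "\<And>x y. \<lbrakk>x \<in> carrier L; y \<in> carrier L\<rbrakk> \<Longrightarrow> x \<sqinter> y \<in> U \<longleftrightarrow> x \<in> U \<and> y \<in> U"
    "\<And>x y. \<lbrakk>x \<in> carrier L; y \<in> carrier L\<rbrakk> \<Longrightarrow> x \<squnion> y \<in> U \<longleftrightarrow> x \<in> U \<or> y \<in> U"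
    using U by (auto simp: prime_filter_def lattice_filter_def)
  \<comment> \<open>Compatibility with the implication in the second coordinate.\<close>
  have 2: "\<And>x y. \<lbrakk>x \<in> carrier L; y \<in> carrier L\<rbrakk> \<Longrightarrow> (x \<leadsto> y)\<acute> \<in> U \<longleftrightarrow> x\<acute> \<notin> U \<and> y\<acute> \<in> U"
    using prime_filter_imp[OF V] by (auto simp: imp_closed)
  show ?thesis
    by (auto simp: dqd_hom_def filter_hom_def D2_def four_vee_def four_wedge_def 1 2
        prime_wedge prime_vee prime_zero prime_one prime_prime prime_closed prime_filter_imp[OF U])
qed

lemma D2_homs_separate:
  assumes xy: "x \<in> carrier L" "y \<in> carrier L" "x \<noteq> y"
  obtains h where "h \<in> dqd_hom L D2" "h x \<noteq> h y"
proof -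
  have "\<exists>h\<in>dqd_hom L D2. h x \<noteq> h y"
    if xy: "x \<in> carrier L" "y \<in> carrier L" "x \<sqinter> y \<noteq> x" for x y
  proof -
    have "x \<sqinter> y\<^sup>\<star> \<noteq> \<bottom>" using le_if_wedge_pcomp_zero xy by blast
    then obtain U where U: "prime_filter U" "x \<sqinter> y\<^sup>\<star> \<in> U"
      using prime_filter_exists xy by (metis wedge_closed pcomp_closed)
    then have "x \<in> U" "y\<^sup>\<star> \<in> U"
      using xy by (auto simp: prime_filter_def lattice_filter_def pcomp_closed)
    moreover have "y \<notin> U"
      using \<open>y\<^sup>\<star> \<in> U\<close> U(1) wedge_pcomp[of y] xy pcomp_closed[of y]
      unfolding prime_filter_def lattice_filter_def by metis
    ultimately have "filter_hom U x \<noteq> filter_hom U y" by (simp add: filter_hom_def)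
    then show ?thesis using filter_hom_in_dqd_hom[OF U(1)] by blast
  qed
  moreover have "x \<sqinter> y \<noteq> x \<or> y \<sqinter> x \<noteq> y" using xy wedge_comm by metis
  ultimately show thesis using xy that by metis
qed

end

section \<open>Products, subalgebras and homomorphic images\<close>

lemma carrier_dqd_product: "carrier (dqd_product I F) = (\<Pi>\<^sub>E i\<in>I. carrier (F i))"
  by (simp add: dqd_product_def)

lemma dqd_product_projection:
  assumes "dqd_subalgebra B (dqd_product I F)" "i \<in> I"
  shows "(\<lambda>f. f i) \<in> dqd_hom B (F i)"
  using assms by (auto simp: dqd_subalgebra_def dqd_product_def dqd_hom_def)

lemma in_HSP_D2_imp:
  assumes "in_HSP TYPE('i) {D2} A"
  shows "involutive_JIDL1 A"
proof -
  obtain I :: "'i set" and F B h where F: "\<forall>i\<in>I. F i \<in> {D2}"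
    and B: "dqd_subalgebra B (dqd_product I F)"
    and h: "h \<in> dqd_hom B A" "h ` carrier B = carrier A"
    using assms unfolding in_HSP_def by (elim exE conjE) (rule that; assumption)
  have sig: "dqd_signature B" and BL: "carrier B \<subseteq> (\<Pi>\<^sub>E i\<in>I. carrier (F i))"
    using B by (auto simp: dqd_subalgebra_def dqd_product_def)
  \<comment> \<open>The points of a subalgebra of a power of \<open>D2\<close> are separated by the coordinate projections.\<close>
  have "involutive_JIDL1 B"
  proof (rule involutive_JIDL1_separated[OF sig involutive_JIDL1_D2])
    show "(\<lambda>i f. f i) ` I \<subseteq> dqd_hom B D2"
      using dqd_product_projection[OF B] F by auto
  next
    fix x y
    assume x: "x \<in> carrier B" and y: "y \<in> carrier B"
      and eq: "\<And>g. g \<in> (\<lambda>i f. f i) ` I \<Longrightarrow> g x = g y"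
    show "x = y"
      using subsetD[OF BL x] subsetD[OF BL y] eq[OF imageI] by (rule PiE_ext)
  qed
  then show ?thesis by (rule involutive_JIDL1_image[OF _ h])
qed

text \<open>
  Evaluation embeds \<open>A\<close> into the power of \<open>M\<close> indexed by the homomorphisms from \<open>A\<close> to \<open>M\<close>, which form
  a set of functions of type \<open>'a \<Rightarrow> 'b\<close>.  The inverse of the embedding exhibits \<open>A\<close> as a homomorphic
  image of a subalgebra of that power.
\<close>
lemma in_HSP_if_homs_separate:
  fixes A :: "'a dqd_alg" and M :: "'b dqd_alg"
  assumes sig: "dqd_signature A"
    and sep: "\<And>x y. \<lbrakk>x \<in> carrier A; y \<in> carrier A; x \<noteq> y\<rbrakk> \<Longrightarrow> \<exists>h\<in>dqd_hom A M. h x \<noteq> h y"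
  shows "in_HSP TYPE('a \<Rightarrow> 'b) {M} A"
proof -
  interpret dqd_signature A by (rule sig)
  note closed = vee_closed wedge_closed imp_closed prime_closed zero_closed one_closed
  define I where "I = dqd_hom A M"
  define P where "P = dqd_product I (\<lambda>_. M)"
  define e where "e x = (\<lambda>g\<in>I. g x)" for x
  define B where "B = P\<lparr>carrier := e ` carrier A\<rparr>"
  have I: "\<And>g. g \<in> I \<Longrightarrow> g \<in> dqd_hom A M" by (simp add: I_def)
  have inj: "inj_on e (carrier A)"
    using sep unfolding inj_on_def e_def I_def by (metis restrict_apply')
  have e: "e x \<squnion>\<^bsub>B\<^esub> e y = e (x \<squnion>\<^bsub>A\<^esub> y)" "e x \<sqinter>\<^bsub>B\<^esub> e y = e (x \<sqinter>\<^bsub>A\<^esub> y)"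
    "e x \<leadsto>\<^bsub>B\<^esub> e y = e (x \<leadsto>\<^bsub>A\<^esub> y)" "(e x)\<acute>\<^bsub>B\<^esub> = e (x\<acute>\<^bsub>A\<^esub>)"
    if "x \<in> carrier A" "y \<in> carrier A" for x y
    using that by (auto simp: B_def P_def dqd_product_def e_def dqd_homD[OF I] intro!: restrict_ext)
  have e0: "\<bottom>\<^bsub>B\<^esub> = e \<bottom>\<^bsub>A\<^esub>" "\<top>\<^bsub>B\<^esub> = e \<top>\<^bsub>A\<^esub>"
    by (auto simp: B_def P_def dqd_product_def e_def dqd_homD[OF I] intro!: restrict_ext)
  have carr: "carrier B = e ` carrier A" by (simp add: B_def)
  have sub: "e ` carrier A \<subseteq> carrier P"
    by (auto simp: P_def carrier_dqd_product e_def dqd_homD[OF I])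
  have "dqd_signature B"
    by unfold_locales (auto simp: carr e e0 closed)
  then have "dqd_subalgebra B P"
    using sub by (auto simp: dqd_subalgebra_def B_def)
  moreover have "inv_into (carrier A) e \<in> dqd_hom B A"
    unfolding dqd_hom_def by (auto simp: carr e e0 closed inv_into_f_f[OF inj])
  moreover have "inv_into (carrier A) e ` carrier B = carrier A"
    by (simp add: carr inv_into_image_cancel[OF inj])
  ultimately show ?thesis
    unfolding in_HSP_def P_def
    by (intro exI[of _ I] exI[of _ "\<lambda>_. M"] exI[of _ B] exI[of _ "inv_into (carrier A) e"])
      simp
qed

theorem corollary7p3:
  fixes A :: "'a dqd_alg"
  shows "(in_HSP TYPE('i) {D2} A \<longrightarrow>
            JIDL1 A \<and> (\<forall>x\<in>carrier A. x\<acute>\<^bsub>A\<^esub>\<acute>\<^bsub>A\<^esub> = x)) \<and>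
         (JIDL1 A \<and> (\<forall>x\<in>carrier A. x\<acute>\<^bsub>A\<^esub>\<acute>\<^bsub>A\<^esub> = x) \<longrightarrow>
            in_HSP TYPE('a \<Rightarrow> four) {D2} A)"
proof (intro conjI impI)
  assume "in_HSP TYPE('i) {D2} A"
  then interpret involutive_JIDL1 A by (rule in_HSP_D2_imp)
  show "JIDL1 A" by unfold_locales
  show "\<forall>x\<in>carrier A. x\<acute>\<^bsub>A\<^esub>\<acute>\<^bsub>A\<^esub> = x" by (simp add: prime_prime)
next
  assume "JIDL1 A \<and> (\<forall>x\<in>carrier A. x\<acute>\<^bsub>A\<^esub>\<acute>\<^bsub>A\<^esub> = x)"
  then interpret involutive_JIDL1 A
    by (simp add: involutive_JIDL1_def involutive_JIDL1_axioms_def)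
  show "in_HSP TYPE('a \<Rightarrow> four) {D2} A"
    by (rule in_HSP_if_homs_separate[OF dqd_signature_axioms]) (metis D2_homs_separate)
qed

end
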